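(* Let $m\in\mathbb{N}$, let $P_1(x_1),\ldots,P_m(x_m)$ be polynomials, and let $n\in\mathbb{N}_0$. Then $$\mathbb{Y}_{n+1}\left(P(\overrightarrow{X_m})\right)=-\frac{1}{n+1}\sum_{j=1}^{m}jP_j(x_j)\,\mathbb{Y}_{n-j+1}^{(2)}\left(P(\overrightarrow{X_m})\right).$$
   Context: $\mathbb{N}=\{1,2,\ldots\}$ and $\mathbb{N}_0=\{0,1,2,\ldots\}$. The $P_j(x_j)$ are arbitrary polynomials (say with complex coefficients) in the indicated variables, and $P(\overrightarrow{X_m})=(P_1(x_1),\ldots,P_m(x_m))$. The polynomials $\mathbb{Y}_n$ and $\mathbb{Y}_n^{(2)}$, $n\ge0$, are defined by the power series expansions in $w$ $$\frac{1}{1+\sum_{j=1}^{m}P_j(x_j)w^j}=\sum_{n=0}^{\infty}\mathbb{Y}_n\left(P(\overrightarrow{X_m})\right)w^n,\qquad \frac{1}{\left(1+\sum_{j=1}^{m}P_j(x_j)w^j\right)^{2}}=\sum_{n=0}^{\infty}\mathbb{Y}_n^{(2)}\left(P(\overrightarrow{X_m})\right)w^n.$$ Convention: $\mathbb{Y}_i^{(2)}(P(\overrightarrow{X_m}))=0$ for $i<0$. *)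

theory Defs
  imports Complex_Main
    "HOL-Library.Poly_Mapping"
    "HOL-Computational_Algebra.Polynomial"
    "HOL-Computational_Algebra.Formal_Power_Series"
begin

text \<open>
  Polynomials in the variables \<open>x\<^sub>0, x\<^sub>1, x\<^sub>2, \<dots>\<close> over \<open>'a\<close>: finitely supported maps from exponent
  vectors to coefficients, with the (convolution) ring structure of \<open>Poly_Mapping\<close>.
\<close>

type_synonym 'a mvpoly = "(nat \<Rightarrow>\<^sub>0 nat) \<Rightarrow>\<^sub>0 'a"

definition mv_const :: "'a::zero \<Rightarrow> 'a mvpoly" where
  "mv_const c = Poly_Mapping.single 0 c"

definition poly_in_var :: "'a::comm_monoid_add poly \<Rightarrow> nat \<Rightarrow> 'a mvpoly" where
  "poly_in_var p j =
     (\<Sum>i\<le>Polynomial.degree p. Poly_Mapping.single (Poly_Mapping.single j i) (coeff p i))"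

text \<open>
  The vector \<open>(P\<^sub>1(x\<^sub>1), \<dots>, P\<^sub>m(x\<^sub>m))\<close> as a function of the index; only the entries \<open>1, \<dots>, m\<close> are
  ever used.
\<close>

definition poly_vector :: "(nat \<Rightarrow> 'a::comm_monoid_add poly) \<Rightarrow> nat \<Rightarrow> 'a mvpoly" where
  "poly_vector P = (\<lambda>j. poly_in_var (P j) j)"

definition Y_denom :: "nat \<Rightarrow> (nat \<Rightarrow> 'a::comm_ring_1) \<Rightarrow> 'a fps" where
  "Y_denom m p = 1 + (\<Sum>j=1..m. fps_const (p j) * fps_X ^ j)"

text \<open>
  The coefficient ring need not be a field, so the reciprocal of a power series \<open>F\<close> with constant
  term \<open>1\<close> is \<open>fps_left_inverse F 1\<close>, where \<open>1\<close> is the inverse of the constant term.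
\<close>

definition Y_poly :: "nat \<Rightarrow> (nat \<Rightarrow> 'a::comm_ring_1) \<Rightarrow> nat \<Rightarrow> 'a" where
  "Y_poly m p n = fps_nth (fps_left_inverse (Y_denom m p) 1) n"

definition Y2_poly :: "nat \<Rightarrow> (nat \<Rightarrow> 'a::comm_ring_1) \<Rightarrow> int \<Rightarrow> 'a" where
  "Y2_poly m p i =
     (if i < 0 then 0 else fps_nth (fps_left_inverse ((Y_denom m p)\<^sup>2) 1) (nat i))"

lemma Y_denom_nth_0: "fps_nth (Y_denom m p) 0 = 1"
  by (simp add: Y_denom_def fps_sum_nth)

lemma Y_poly_generating: "Y_denom m p * Abs_fps (Y_poly m p) = 1"
proof -
  have "Abs_fps (Y_poly m p) = fps_left_inverse (Y_denom m p) 1"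
    by (simp add: fps_eq_iff Y_poly_def)
  then show ?thesis
    using fps_left_inverse[of 1 "Y_denom m p"] by (simp add: Y_denom_nth_0 mult.commute)
qed

lemma Y2_poly_generating: "(Y_denom m p)\<^sup>2 * Abs_fps (\<lambda>n. Y2_poly m p (int n)) = 1"
proof -
  have "Abs_fps (\<lambda>n. Y2_poly m p (int n)) = fps_left_inverse ((Y_denom m p)\<^sup>2) 1"
    by (simp add: fps_eq_iff Y2_poly_def)
  then show ?thesis
    using fps_left_inverse[of 1 "(Y_denom m p)\<^sup>2"]
    by (simp add: Y_denom_nth_0 fps_nth_power_0 mult.commute)
qed

end

theory Submission
  imports Defs
begin

text \<open>
  Write \<open>D\<close> for the denominator and \<open>G\<close> for its reciprocal in the ring of formal power series in
  \<open>w\<close>. Differentiating \<open>D G = 1\<close> with respect to \<open>w\<close> and multiplying by \<open>G\<close> gives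
  \<open>G' = - D' G\<^sup>2\<close>, where \<open>D' = \<Sum>j. j p\<^sub>j w\<^bsup>j-1\<^esup>\<close>. The coefficient of \<open>w\<^sup>n\<close> is \<open>(n+1)\<close> times the claimed
  identity (\<open>coefficient_recurrence\<close>). That much holds over every commutative ring; only the
  final division by \<open>n+1\<close> needs the constants \<open>1/(n+1)\<close> inside the ring of
  polynomials (\<open>mv_const_inverse_of_nat\<close>).
\<close>

lemma deriv_left_inverse_eq:
  fixes D G H :: "'a::comm_ring_1 fps"
  assumes DG: "D * G = 1" and DH: "D\<^sup>2 * H = 1"
  shows "fps_deriv G = - (fps_deriv D * H)"
proof -
  have "G\<^sup>2 = (D\<^sup>2 * H) * G\<^sup>2"
    by (simp add: DH)
  also have "\<dots> = (D * G)\<^sup>2 * H"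
    by (simp add: power_mult_distrib mult_ac)
  finally have H: "H = G\<^sup>2"
    by (simp add: DG)
  have "D * fps_deriv G + fps_deriv D * G = fps_deriv (D * G)"
    by simp
  then have "D * fps_deriv G = - (fps_deriv D * G)"
    by (simp add: DG eq_neg_iff_add_eq_0)
  then have "G * (D * fps_deriv G) = - (fps_deriv D * G\<^sup>2)"
    by (simp add: power2_eq_square mult_ac)
  moreover have "G * (D * fps_deriv G) = (D * G) * fps_deriv G"
    by (simp add: mult_ac)
  ultimately show ?thesis
    by (simp add: DG H)
qed

lemma fps_deriv_Y_denom:
  "fps_deriv (Y_denom m p) = (\<Sum>j=1..m. fps_const (of_nat j * p j) * fps_X ^ (j - 1))"
proof -
  have "fps_deriv (fps_const c * fps_X ^ j) = fps_const (of_nat j * c) * fps_X ^ (j - 1)"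
    for c :: 'a and j
    by (rule fps_ext) (cases j; auto simp: fps_X_power_nth algebra_simps)
  then show ?thesis
    by (simp add: Y_denom_def fps_deriv_sum)
qed

text \<open>
  Multiplying by \<open>w\<^bsup>j-1\<^esup>\<close> shifts the coefficients of the squared reciprocal by \<open>j - 1\<close>, which is where
  the index \<open>n - j + 1\<close> comes from; the convention for negative indices absorbs the terms with \<open>j > n + 1\<close>.
\<close>

lemma coefficient_recurrence:
  fixes p :: "nat \<Rightarrow> 'a::comm_ring_1"
  shows "of_nat (n + 1) * Y_poly m p (n + 1) =
           - (\<Sum>j=1..m. of_nat j * p j * Y2_poly m p (int n - int j + 1))"
proof -
  let ?G = "Abs_fps (Y_poly m p)" and ?H = "Abs_fps (\<lambda>n. Y2_poly m p (int n))"
  have shift: "fps_nth (fps_const c * fps_X ^ (j - 1) * ?H) n = c * Y2_poly m p (int n - int j + 1)"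
    if "j \<in> {1..m}" for c j
  proof (cases "n < j - 1")
    case True
    then show ?thesis
      by (simp add: mult.assoc fps_X_power_mult_nth Y2_poly_def)
  next
    case False
    with that have "int n - int j + 1 = int (n - (j - 1))"
      by auto
    then show ?thesis
      using False by (simp only: mult.assoc fps_X_power_mult_nth fps_mult_left_const_nth
          fps_nth_Abs_fps if_False)
  qed
  have "of_nat (n + 1) * Y_poly m p (n + 1) = fps_nth (fps_deriv ?G) n"
    by simp
  also have "\<dots> = - fps_nth (fps_deriv (Y_denom m p) * ?H) n"
    by (simp add: deriv_left_inverse_eq[OF Y_poly_generating Y2_poly_generating])
  also have "fps_nth (fps_deriv (Y_denom m p) * ?H) n =
      (\<Sum>j=1..m. of_nat j * p j * Y2_poly m p (int n - int j + 1))"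
    unfolding fps_deriv_Y_denom sum_distrib_right fps_sum_nth
    by (rule sum.cong[OF refl shift])
  finally show ?thesis .
qed

lemma mv_const_inverse_of_nat:
  assumes "k \<noteq> 0"
  shows "mv_const (1 / of_nat k :: 'a::field_char_0) * of_nat k = 1"
  using assms
  by (simp add: mv_const_def mult_single flip: single_of_nat single_one)

theorem theorem18:
  fixes m n :: nat and P :: "nat \<Rightarrow> complex poly"
  assumes "m \<ge> 1"
  shows "Y_poly m (poly_vector P) (n + 1) =
           - (mv_const (1 / of_nat (n + 1)) *
              (\<Sum>j=1..m. of_nat j * poly_in_var (P j) j *
                 Y2_poly m (poly_vector P) (int n - int j + 1)))"
proof -
  let ?c = "mv_const (1 / of_nat (n + 1) :: complex)"
  have "Y_poly m (poly_vector P) (n + 1) =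
      ?c * of_nat (n + 1) * Y_poly m (poly_vector P) (n + 1)"
    by (subst mv_const_inverse_of_nat) simp_all
  also have "\<dots> = ?c * (of_nat (n + 1) * Y_poly m (poly_vector P) (n + 1))"
    by (rule mult.assoc)
  also have "\<dots> = - (?c * (\<Sum>j=1..m. of_nat j * poly_vector P j *
      Y2_poly m (poly_vector P) (int n - int j + 1)))"
    unfolding coefficient_recurrence by (rule mult_minus_right)
  finally show ?thesis
    by (simp only: poly_vector_def)
qed

end
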